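(* Let $A_0\ge 1$ be an integer, let $h_0=8A_0-1$ (so $h_0$ has base value $7$ and octave index $A_0$), and let $h_{i+1}=T(h_i)$ for $i\ge 0$. The number $t$ of consecutive base-7 self-loop steps $7\to 7$ starting at $h_0$ satisfies $$t\le v_2(A_0).$$ Each $7\to7$ step requires the current octave index $A$ to be even and updates it by $A\mapsto \tfrac32 A$, decreasing $v_2(A)$ by one. After at most $v_2(A_0)$ such steps the octave index becomes odd, and the next base transition is then forced to be $7\to 3$.
   Context: The (generalized, accelerated) Collatz map $T$ on positive integers is $T(h)=h/2$ if $h$ is even and $T(h)=(3h+1)/2$ if $h$ is odd. Every positive integer $h$ is written uniquely as $h=B+8(A-1)$ with base value $B\in\{1,\dots,8\}$ and octave index $A\ge 1$. A step from $h$ to $T(h)$ is a base transition $B\to B'$ if $h$ has base value $B$ and $T(h)$ has base value $B'$; a $7\to 7$ step is one where both base values equal $7$. $v_2(A)$ denotes the exponent of $2$ in $A$. *)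

theory Defs
  imports "HOL-Computational_Algebra.Computational_Algebra" "HOL-Library.Extended_Nat"
begin

text \<open>The positive integers are the nonzero elements of \<^typ>\<open>nat\<close>; the values of the
  functions below at \<open>0\<close> are irrelevant.\<close>

definition collatz :: "nat \<Rightarrow> nat" where
  "collatz h = (if even h then h div 2 else (3 * h + 1) div 2)"

definition base_value :: "nat \<Rightarrow> nat" where
  "base_value h = (h - 1) mod 8 + 1"

definition octave_index :: "nat \<Rightarrow> nat" where
  "octave_index h = (h - 1) div 8 + 1"

text \<open>These two functions give the unique decomposition \<open>h = B + 8 (A - 1)\<close> with
  \<open>B \<in> {1..8}\<close> and \<open>A \<ge> 1\<close>.\<close>

lemma base_octave_iff:
  assumes "h \<ge> 1"
  shows "B \<in> {1..8} \<and> A \<ge> 1 \<and> h = B + 8 * (A - 1) \<longleftrightarrow> B = base_value h \<and> A = octave_index h"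
proof
  assume *: "B \<in> {1..8} \<and> A \<ge> 1 \<and> h = B + 8 * (A - 1)"
  then have "h - 1 = (B - 1) + 8 * (A - 1)" and "B - 1 < 8"
    by auto
  then have "(h - 1) mod 8 = B - 1" and "(h - 1) div 8 = A - 1"
    by simp_all
  then show "B = base_value h \<and> A = octave_index h"
    using * by (simp add: base_value_def octave_index_def)
next
  assume *: "B = base_value h \<and> A = octave_index h"
  have "h = (h - 1) mod 8 + 1 + 8 * ((h - 1) div 8)"
    using assms mod_mult_div_eq[of "h - 1" 8] by linarith
  moreover have "(h - 1) mod 8 < 8"
    by simp
  ultimately show "B \<in> {1..8} \<and> A \<ge> 1 \<and> h = B + 8 * (A - 1)"
    using * by (simp add: base_value_def octave_index_def Suc_le_eq)
qed

definition base_transition :: "nat \<Rightarrow> nat \<Rightarrow> nat \<Rightarrow> bool" where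
  "base_transition B B' h \<longleftrightarrow> base_value h = B \<and> base_value (collatz h) = B'"

text \<open>The number of consecutive \<open>7 \<rightarrow> 7\<close> steps at the start of an orbit; it is \<open>\<infinity>\<close> if all steps
  of the orbit are of this kind, so that a finite bound on it is not vacuous.\<close>

definition self_loop_run :: "(nat \<Rightarrow> nat) \<Rightarrow> enat" where
  "self_loop_run h = Sup {enat t | t. \<forall>i<t. base_transition 7 7 (h i)}"

end

theory Submission
  imports Defs
begin

text \<open>
  A number of base value \<open>7\<close> and octave index \<open>A\<close> is \<open>8 A - 1\<close>, and the Collatz map sends it to
  \<open>12 A - 1\<close>. Modulo \<open>8\<close> this depends only on the parity of \<open>A\<close>: for even \<open>A\<close> it equals
  \<open>8 (3 A / 2) - 1\<close>, so the base value stays \<open>7\<close> and one factor \<open>2\<close> of \<open>A\<close> is traded for a factor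
  \<open>3\<close>; for odd \<open>A\<close> it is congruent to \<open>3\<close>. Hence a \<open>7 \<rightarrow> 7\<close> step consumes exactly one factor \<open>2\<close> of the
  octave index, and the run goes on as long as such a factor is left.

  So with \<open>A\<^sub>0 = 2 ^ v * m\<close>, \<open>m\<close> odd, the octave index after \<open>i \<le> v\<close> steps is \<open>3 ^ i * 2 ^ (v - i) * m\<close>
  (\<open>orbit_base7\<close>). It is even for \<open>i < v\<close> and odd for \<open>i = v\<close>, so the run has length exactly
  \<open>v = v\<^sub>2(A\<^sub>0)\<close> (the bound is attained) and it ends in a \<open>7 \<rightarrow> 3\<close> transition.
\<close>

lemma
  assumes "A \<ge> 1"
  shows base_value_base7: "base_value (8 * A - 1) = 7"
    and octave_index_base7: "octave_index (8 * A - 1) = A"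
proof -
  have "8 * A - 1 \<ge> 1" and "8 * A - 1 = 7 + 8 * (A - 1)"
    using assms by linarith+
  then show "base_value (8 * A - 1) = 7" and "octave_index (8 * A - 1) = A"
    using base_octave_iff[of "8 * A - 1" 7 A] assms by auto
qed

lemma base7_eq:
  assumes "h \<ge> 1" and "base_value h = 7"
  shows "h = 8 * octave_index h - 1" and "octave_index h \<ge> 1"
  using base_octave_iff[of h 7 "octave_index h"] assms by auto

lemma collatz_base7_even:
  assumes "m \<ge> 1"
  shows "collatz (8 * (2 * m) - 1) = 8 * (3 * m) - 1"
proof -
  from assms obtain n where "m = Suc n"
    by (cases m) auto
  then have "8 * (2 * m) - 1 = 2 * (8 * n + 7) + 1" and "8 * (3 * m) - 1 = 24 * n + 23"
    by simp_all
  then show ?thesis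
    by (simp add: collatz_def)
qed

lemma collatz_base7_odd: "collatz (8 * (2 * m + 1) - 1) = 3 + 8 * (3 * m + 1)"
proof -
  have "8 * (2 * m + 1) - 1 = 2 * (8 * m + 3) + 1"
    by simp
  then show ?thesis
    by (simp add: collatz_def)
qed

lemma base_transition_7_7:
  assumes "m \<ge> 1"
  shows "base_transition 7 7 (8 * (2 * m) - 1)"
  using base_value_base7[of "2 * m"] base_value_base7[of "3 * m"] collatz_base7_even[OF assms] assms
  by (simp add: base_transition_def)

lemma base_transition_7_3: "base_transition 7 3 (8 * (2 * m + 1) - 1)"
proof -
  have "base_value (3 + 8 * (3 * m + 1)) = 3"
    using base_octave_iff[of "3 + 8 * (3 * m + 1)" 3 "3 * m + 2"] by simp
  then show ?thesis
    using base_value_base7[of "2 * m + 1"] unfolding base_transition_def collatz_base7_odd by simp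
qed

lemma base7_odd_transition:
  assumes "k \<ge> 1" and "base_value k = 7" and "odd (octave_index k)"
  shows "base_transition 7 3 k"
  using base_transition_7_3 base7_eq(1)[OF assms(1,2)] assms(3) by (metis oddE)

text \<open>Odd octave indices are excluded because they force \<open>7 \<rightarrow> 3\<close>. What remains is the explicit
  update \<open>2 m \<mapsto> 3 m\<close>, which removes one factor \<open>2\<close> as \<open>3\<close> is coprime to \<open>2\<close>.\<close>

lemma self_loop_step:
  assumes "k \<ge> 1" and "base_transition 7 7 k"
  obtains m where "m \<ge> 1" and "octave_index k = 2 * m" and "octave_index (collatz k) = 3 * m"
proof -
  have b: "base_value k = 7"
    using assms(2) by (simp add: base_transition_def)
  have "even (octave_index k)"
    using base7_odd_transition[OF assms(1) b] assms(2) by (auto simp: base_transition_def)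
  then obtain m where m: "octave_index k = 2 * m"
    by (elim evenE)
  with base7_eq[OF assms(1) b] have "m \<ge> 1" and "k = 8 * (2 * m) - 1"
    by auto
  then show thesis
    using that[OF _ m] octave_index_base7[of "3 * m"] collatz_base7_even[of m] by simp
qed

lemma multiplicity_2_triple:
  fixes m :: nat
  assumes "m \<ge> 1"
  shows "multiplicity 2 (3 * m) + 1 = multiplicity 2 (2 * m)"
proof -
  have "multiplicity 2 (3 * m) = multiplicity 2 m"
    using assms by (subst prime_elem_multiplicity_mult_distrib) (auto intro: not_dvd_imp_multiplicity_0)
  moreover have "multiplicity 2 (2 * m) = Suc (multiplicity 2 m)"
    using assms by (intro multiplicity_times_same) auto
  ultimately show ?thesis
    by simp
qed

lemma orbit_base7:
  fixes h :: "nat \<Rightarrow> nat"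
  assumes "m \<ge> 1" and "h 0 = 8 * (2 ^ v * m) - 1" and "\<And>i. h (Suc i) = collatz (h i)" and "i \<le> v"
  shows "h i = 8 * (3 ^ i * 2 ^ (v - i) * m) - 1"
  using assms(4)
proof (induction i)
  case 0
  then show ?case
    using assms(2) by simp
next
  case (Suc i)
  then have "v - i = Suc (v - Suc i)"
    by simp
  with Suc have "h i = 8 * (2 * (3 ^ i * 2 ^ (v - Suc i) * m)) - 1"
    by (simp add: mult_ac)
  then show ?case
    using collatz_base7_even[of "3 ^ i * 2 ^ (v - Suc i) * m"] assms(1,3)
    by (simp add: mult_ac Suc_le_eq)
qed

lemma self_loop_run_eqI:
  assumes "\<And>i. i < t \<Longrightarrow> base_transition 7 7 (h i)" and "\<not> base_transition 7 7 (h t)"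
  shows "self_loop_run h = enat t"
  unfolding self_loop_run_def
proof (rule antisym)
  show "Sup {enat t | t. \<forall>i<t. base_transition 7 7 (h i)} \<le> enat t"
  proof (rule Sup_least, clarify)
    fix s
    assume "\<forall>i<s. base_transition 7 7 (h i)"
    then show "enat s \<le> enat t"
      using assms(2) by (auto simp flip: not_less)
  qed
  show "enat t \<le> Sup {enat t | t. \<forall>i<t. base_transition 7 7 (h i)}"
    using assms(1) by (auto intro!: Sup_upper)
qed

theorem proposition8p4:
  fixes A0 :: nat and h :: "nat \<Rightarrow> nat"
  assumes "A0 \<ge> 1"
    and "h 0 = 8 * A0 - 1"
    and "\<And>i. h (Suc i) = collatz (h i)"
  shows "base_value (h 0) = 7 \<and> octave_index (h 0) = A0
    \<and> self_loop_run h \<le> enat (multiplicity 2 A0)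
    \<and> (\<forall>k\<ge>1. base_transition 7 7 k \<longrightarrow>
          even (octave_index k)
          \<and> real (octave_index (collatz k)) = 3 / 2 * real (octave_index k)
          \<and> multiplicity 2 (octave_index (collatz k)) + 1 = multiplicity 2 (octave_index k))
    \<and> (\<forall>k\<ge>1. base_value k = 7 \<and> odd (octave_index k) \<longrightarrow> base_transition 7 3 k)
    \<and> (\<exists>t. self_loop_run h = enat t \<and> t \<le> multiplicity 2 A0
          \<and> odd (octave_index (h t)) \<and> base_transition 7 3 (h t))"
proof -
  define v where "v = multiplicity 2 A0"
  obtain m where A0: "A0 = 2 ^ v * m" and "odd m"
    using multiplicity_decompose'[of A0 2] assms(1) unfolding v_def by auto
  then have "m \<ge> 1"
    by (cases m) auto
  note orbit = orbit_base7[OF \<open>m \<ge> 1\<close> assms(2)[unfolded A0] assms(3)]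
  have loops: "base_transition 7 7 (h i)" if "i < v" for i
  proof -
    have "v - i = Suc (v - Suc i)"
      using that by simp
    then have "h i = 8 * (2 * (3 ^ i * 2 ^ (v - Suc i) * m)) - 1"
      using orbit[of i] that by (simp add: mult_ac)
    then show ?thesis
      using base_transition_7_7[of "3 ^ i * 2 ^ (v - Suc i) * m"] \<open>m \<ge> 1\<close> by (simp add: Suc_le_eq)
  qed
  have h_v: "h v = 8 * (3 ^ v * m) - 1"
    using orbit[of v] by simp
  have pos: "3 ^ v * m \<ge> 1"
    using \<open>m \<ge> 1\<close> by (simp add: Suc_le_eq)
  have odd_v: "odd (octave_index (h v))"
    unfolding h_v octave_index_base7[OF pos] using \<open>odd m\<close> by simp
  have "h v \<ge> 1" and "base_value (h v) = 7"
    using base_value_base7[OF pos] pos unfolding h_v by linarith+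
  then have exit: "base_transition 7 3 (h v)"
    using odd_v by (rule base7_odd_transition)
  then have run: "self_loop_run h = enat v"
    by (intro self_loop_run_eqI loops) (auto simp: base_transition_def)
  have step: "even (octave_index k)
      \<and> real (octave_index (collatz k)) = 3 / 2 * real (octave_index k)
      \<and> multiplicity 2 (octave_index (collatz k)) + 1 = multiplicity 2 (octave_index k)"
    if "k \<ge> 1" and "base_transition 7 7 k" for k
    using that by (rule self_loop_step) (simp add: multiplicity_2_triple[simplified])
  show ?thesis
    using base_value_base7[OF assms(1)] octave_index_base7[OF assms(1)] assms(2)
      run step base7_odd_transition odd_v exit
    unfolding v_def by auto
qed

end
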